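(* Let $X$ be a Banach space over $\mathbb K$ and let $\omega_0$ be such that $(X,\omega_0)$ is a symplectic Banach space, with a maximal isotropic subspace $\lambda$. Assume that $\gamma_\lambda>0$ if $h_\lambda\neq 0$ (where $h_\lambda,\gamma_\lambda$ are the sign and the reduced minimum modulus of $\lambda$ in $(X,\omega_0)$). Let $\omega$ be a form on the same Banach space $X$ such that $(X,\omega)$ is a symplectic Banach space, and let $\mu$ be a closed isotropic subspace of $(X,\omega)$. Set $$l(\mu,\omega):=\Big(|h_\lambda|\gamma_\lambda^{-1}\big(\|L_\omega-L_{\omega_0}\|+\|L_{\omega_0}\|\,\delta(\mu^\omega,\lambda^{\omega_0})(2+\delta(\mu^\omega,\lambda^{\omega_0}))\big)\Big)^{1/2}$$ if $h_\lambda\ne0$, and $l(\mu,\omega):=0$ if $h_\lambda=0$. Assume that $$\delta(\mu^\omega,\lambda^{\omega_0})+l(\mu,\omega)<\frac{1-\delta(\lambda,\mu)}{1+\delta(\lambda,\mu)}.$$ Then $\mu$ is a maximal isotropic subspace of $(X,\omega)$ with $h_\mu\in\{h_\lambda,0\}$.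
   Context: $\mathbb K$ is $\mathbb R$ or $\mathbb C$, and $\mathrm i=\sqrt{-1}$. Sesquilinear forms are linear in the first and conjugate-linear in the second variable (bilinear if $\mathbb K=\mathbb R$). A form $\omega:X\times X\to\mathbb K$ is skew symmetric if $\omega(y,x)=-\overline{\omega(x,y)}$. For a linear subspace $\lambda\subset X$, $\lambda^\omega:=\{y\in X:\omega(x,y)=0\ \forall x\in\lambda\}$; $\omega$ is non-degenerate if $X^\omega=\{0\}$. $(X,\omega)$ is a symplectic Banach space if $X$ is a Banach space and $\omega$ is a bounded non-degenerate skew symmetric sesquilinear form. $X^*$ is the Banach space of bounded conjugate-linear forms on $X$, and $L_\omega:X\to X^*$ is the bounded linear map $(L_\omega x)(y)=\omega(x,y)$. A linear subspace $\lambda$ is isotropic if $\lambda\subset\lambda^\omega$, Lagrangian if $\lambda=\lambda^\omega$, and maximal isotropic if it is isotropic and every isotropic subspace containing $\lambda$ equals $\lambda$. For isotropic $\lambda$, the form $\tilde\omega(x+\lambda,y+\lambda):=\omega(x,y)$ is well defined on $\lambda^\omega/\lambda$. If $\lambda$ is maximal isotropic, then $\lambda=\lambda^{\omega\omega}$ is closed and either $\lambda=\lambda^\omega$, or $\mathbb K=\mathbb C$ and $\mathrm i\tilde\omega$ is (positive or negative) definite on $\lambda^\omega/\lambda\neq\{0\}$. The sign $h_\lambda$ is $0$ if $\lambda=\lambda^\omega$, and otherwise $h_\lambda=\pm1$ when $\pm\mathrm i\tilde\omega$ is positive definite on $\lambda^\omega/\lambda$. The reduced minimum modulus is $\gamma_\lambda:=\inf_{x\in\lambda^\omega\setminus\lambda}\frac{\mathrm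 i h_\lambda\omega(x,x)}{\operatorname{dist}(x,\lambda)^2}$ if $\lambda\subsetneq\lambda^\omega$, and $\gamma_\lambda:=0$ if $\lambda=\lambda^\omega$. For closed subspaces $M,N$ of $X$: $\delta(M,N):=\sup_{u\in M,\|u\|=1}\operatorname{dist}(u,N)$ if $M\neq\{0\}$, and $\delta(\{0\},N):=0$. *)

theory Defs
  imports "HOL-Analysis.Analysis"
begin

section \<open>The scalar field\<close>

text \<open>
  Up to isometric isomorphism (injectivity of \<open>to_complex\<close> follows from \<open>norm_to_complex\<close>), the
  instances of the following class are exactly \<open>\<real>\<close> and \<open>\<complex>\<close>. The embedding into \<open>\<complex>\<close> gives a meaning to
  \<open>\<i> \<omega>(x, x)\<close> over either field.
\<close>

class rc_field = real_normed_field +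
  fixes to_complex :: "'a \<Rightarrow> complex" and conj :: "'a \<Rightarrow> 'a"
  assumes to_complex_add: "to_complex (a + b) = to_complex a + to_complex b"
    and to_complex_mult: "to_complex (a * b) = to_complex a * to_complex b"
    and to_complex_scaleR: "to_complex (r *\<^sub>R a) = r *\<^sub>R to_complex a"
    and norm_to_complex: "norm (to_complex a) = norm a"
    and to_complex_conj: "to_complex (conj a) = cnj (to_complex a)"
    and range_to_complex: "range to_complex = \<real> \<or> range to_complex = UNIV"

instantiation real :: rc_field
begin

definition to_complex_real :: "real \<Rightarrow> complex" where "to_complex_real = complex_of_real"
definition conj_real :: "real \<Rightarrow> real" where "conj_real = id"

instance
  by standard (auto simp: to_complex_real_def conj_real_def Reals_def scaleR_conv_of_real)

end

instantiation complex :: rc_field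
begin

definition to_complex_complex :: "complex \<Rightarrow> complex" where "to_complex_complex = id"
definition conj_complex :: "complex \<Rightarrow> complex" where "conj_complex = cnj"

instance
  by standard (auto simp: to_complex_complex_def conj_complex_def)

end

section \<open>Symplectic Banach spaces\<close>

text \<open>
  A Banach space over \<open>'k\<close>: the type class \<open>banach\<close> provides the underlying real Banach space, which
  the scalar multiplication \<open>smul\<close> has to extend.
\<close>

locale K_banach = vector_space smul
  for smul :: "'k::rc_field \<Rightarrow> 'a::banach \<Rightarrow> 'a" +
  assumes scale_of_real: "smul (of_real r) x = r *\<^sub>R x"
    and norm_scale: "norm (smul c x) = norm c * norm x"

definition annihilator :: "('a \<Rightarrow> 'a \<Rightarrow> 'k::zero) \<Rightarrow> 'a set \<Rightarrow> 'a set" where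
  "annihilator \<omega> S = {y. \<forall>x\<in>S. \<omega> x y = 0}"

locale symplectic_banach = K_banach smul
  for smul :: "'k::rc_field \<Rightarrow> 'a::banach \<Rightarrow> 'a" +
  fixes \<omega> :: "'a \<Rightarrow> 'a \<Rightarrow> 'k"
  assumes add_left: "\<omega> (x + x') y = \<omega> x y + \<omega> x' y"
    and add_right: "\<omega> x (y + y') = \<omega> x y + \<omega> x y'"
    and scale_left: "\<omega> (smul c x) y = c * \<omega> x y"
    and scale_right: "\<omega> x (smul c y) = conj c * \<omega> x y"
    and skew_symmetric: "\<omega> y x = - conj (\<omega> x y)"
    and bounded: "\<exists>C. \<forall>x y. norm (\<omega> x y) \<le> C * norm x * norm y"
    and non_degenerate: "annihilator \<omega> UNIV = {0}"

text \<open>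
  The map \<open>x \<mapsto> \<omega>(x, \<cdot>)\<close>. Bounded conjugate-linear forms are in particular bounded \<open>\<real>\<close>-linear maps into
  the scalar field, with the same norm; hence \<open>X\<^sup>*\<close> is treated as a subspace of \<open>'a \<Rightarrow>\<^sub>L 'k\<close>, and the norm
  of \<open>'a \<Rightarrow>\<^sub>L 'a \<Rightarrow>\<^sub>L 'k\<close> restricts to the operator norm of maps into \<open>X\<^sup>*\<close>.
\<close>

definition L_map :: "('a::real_normed_vector \<Rightarrow> 'a \<Rightarrow> 'k::real_normed_vector) \<Rightarrow> ('a \<Rightarrow>\<^sub>L 'a \<Rightarrow>\<^sub>L 'k)" where
  "L_map \<omega> = Blinfun (\<lambda>x. Blinfun (\<omega> x))"

context symplectic_banach
begin

lemma conj_of_real: "conj (of_real r :: 'k) = of_real r"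
proof -
  have inj: "a = b" if "to_complex a = to_complex b" for a b :: 'k
  proof -
    have "to_complex (a - b) + to_complex b = to_complex a"
      by (simp flip: to_complex_add)
    with that have "norm (to_complex (a - b)) = 0" by simp
    then show ?thesis by (simp add: norm_to_complex)
  qed
  have 1: "to_complex (1 :: 'k) = 1"
  proof -
    have "to_complex (1 :: 'k) * to_complex (1 :: 'k) = to_complex (1 :: 'k)"
      by (simp flip: to_complex_mult)
    moreover have "to_complex (1 :: 'k) \<noteq> 0"
      using norm_to_complex[of "1 :: 'k"] by auto
    ultimately show ?thesis by simp
  qed
  have "to_complex (of_real r :: 'k) = of_real r"
    by (simp add: of_real_def to_complex_scaleR 1)
  then show ?thesis
    by (intro inj) (simp add: to_complex_conj)
qed

lemma bounded_bilinear_form: "bounded_bilinear \<omega>"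
proof
  show "\<omega> (r *\<^sub>R x) y = r *\<^sub>R \<omega> x y" for r x y
    using scale_left[of "of_real r" x y] by (simp add: scale_of_real scaleR_conv_of_real)
  show "\<omega> x (r *\<^sub>R y) = r *\<^sub>R \<omega> x y" for r x y
    using scale_right[of x "of_real r" y]
    by (simp add: scale_of_real scaleR_conv_of_real conj_of_real)
  show "\<exists>K. \<forall>x y. norm (\<omega> x y) \<le> norm x * norm y * K"
    using bounded by (metis mult.assoc mult.commute)
qed (fact add_left add_right)+

lemma L_map_apply: "L_map \<omega> x y = \<omega> x y"
proof -
  interpret bounded_bilinear \<omega> by (fact bounded_bilinear_form)
  have in_eq: "blinfun_apply (Blinfun (\<omega> x)) = \<omega> x" for x
    by (intro bounded_linear_Blinfun_apply bounded_linear_right)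
  obtain K where K: "\<And>x y. norm (\<omega> x y) \<le> norm x * norm y * K" "0 \<le> K"
    using nonneg_bounded by auto
  have "bounded_linear (\<lambda>x. Blinfun (\<omega> x))"
  proof (rule bounded_linear_intro[where K = K])
    show "norm (Blinfun (\<omega> x)) \<le> norm x * K" for x
    proof (rule norm_blinfun_bound)
      show "0 \<le> norm x * K" using K(2) by simp
      show "norm (blinfun_apply (Blinfun (\<omega> x)) y) \<le> norm x * K * norm y" for y
        using K(1)[of x y] by (simp add: in_eq mult_ac)
    qed
  qed (auto intro!: blinfun_eqI
        simp: in_eq add_left scaleR_left blinfun.add_left blinfun.scaleR_left)
  then show ?thesis
    by (simp add: L_map_def bounded_linear_Blinfun_apply in_eq)
qed

end

section \<open>Isotropic subspaces\<close>

definition isotropic :: "('k::rc_field \<Rightarrow> 'a::banach \<Rightarrow> 'a) \<Rightarrow> ('a \<Rightarrow> 'a \<Rightarrow> 'k) \<Rightarrow> 'a set \<Rightarrow> bool" where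
  "isotropic smul \<omega> S \<longleftrightarrow> module.subspace smul S \<and> S \<subseteq> annihilator \<omega> S"

definition maximal_isotropic ::
    "('k::rc_field \<Rightarrow> 'a::banach \<Rightarrow> 'a) \<Rightarrow> ('a \<Rightarrow> 'a \<Rightarrow> 'k) \<Rightarrow> 'a set \<Rightarrow> bool" where
  "maximal_isotropic smul \<omega> S \<longleftrightarrow>
     isotropic smul \<omega> S \<and> (\<forall>T. isotropic smul \<omega> T \<and> S \<subseteq> T \<longrightarrow> T = S)"

definition coset :: "'a::ab_group_add set \<Rightarrow> 'a \<Rightarrow> 'a set" where
  "coset S x = (\<lambda>s. x + s) ` S"

definition quotient_form :: "('a \<Rightarrow> 'a \<Rightarrow> 'k) \<Rightarrow> 'a set \<Rightarrow> 'a set \<Rightarrow> 'k" where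
  "quotient_form \<omega> A B = (THE c. \<forall>x\<in>A. \<forall>y\<in>B. \<omega> x y = c)"

lemma (in symplectic_banach) quotient_form_coset:
  assumes S: "isotropic smul \<omega> S" and x: "x \<in> annihilator \<omega> S" and y: "y \<in> annihilator \<omega> S"
  shows "quotient_form \<omega> (coset S x) (coset S y) = \<omega> x y"
proof -
  have conj0: "conj (0 :: 'k) = 0"
    using conj_of_real[of 0] by simp
  have "\<omega> (x + s) (y + t) = \<omega> x y" if "s \<in> S" "t \<in> S" for s t
  proof -
    have "\<omega> s y = 0" "\<omega> s t = 0" "\<omega> t x = 0"
      using S x y that by (auto simp: isotropic_def annihilator_def)
    then show ?thesis
      using skew_symmetric[of x t] by (simp add: add_left add_right conj0)
  qed
  moreover have "0 \<in> S"
    using S subspace_0 by (simp add: isotropic_def)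
  ultimately show ?thesis
    unfolding quotient_form_def coset_def by (intro the_equality) (auto, metis add.right_neutral)
qed

text \<open>
  Definiteness on \<open>S\<^sup>\<omega>/S\<close> of \<open>\<epsilon> \<i>\<close> times the induced form, for \<open>\<epsilon> = \<plusminus>1\<close>. By skew symmetry
  \<open>\<i> \<omega>(x, x)\<close> is real, so \<open>Re\<close> is merely a coercion; the coset \<open>S\<close> is the zero of the quotient.
\<close>

definition positive_definite_i ::
    "real \<Rightarrow> ('a::banach \<Rightarrow> 'a \<Rightarrow> 'k::rc_field) \<Rightarrow> 'a set \<Rightarrow> bool" where
  "positive_definite_i \<epsilon> \<omega> S \<longleftrightarrow>
     (\<forall>A \<in> coset S ` annihilator \<omega> S. A \<noteq> S \<longrightarrow>
        0 < Re (of_real \<epsilon> * \<i> * to_complex (quotient_form \<omega> A A)))"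

text \<open>For maximal isotropic \<open>S\<close> the last case does not occur.\<close>

definition iso_sign :: "('a::banach \<Rightarrow> 'a \<Rightarrow> 'k::rc_field) \<Rightarrow> 'a set \<Rightarrow> real" where
  "iso_sign \<omega> S =
     (if S = annihilator \<omega> S then 0
      else if positive_definite_i 1 \<omega> S then 1
      else if positive_definite_i (-1) \<omega> S then -1
      else undefined)"

definition reduced_min_modulus :: "('a::banach \<Rightarrow> 'a \<Rightarrow> 'k::rc_field) \<Rightarrow> 'a set \<Rightarrow> real" where
  "reduced_min_modulus \<omega> S =
     (if S = annihilator \<omega> S then 0
      else INF x \<in> annihilator \<omega> S - S.
        Re (\<i> * of_real (iso_sign \<omega> S) * to_complex (\<omega> x x)) / (infdist x S)\<^sup>2)"

definition gap :: "'a::real_normed_vector set \<Rightarrow> 'a set \<Rightarrow> real" where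
  "gap M N = (if M = {0} then 0 else SUP u \<in> {u \<in> M. norm u = 1}. infdist u N)"

definition l_bound ::
    "('a::banach \<Rightarrow> 'a \<Rightarrow> 'k::rc_field) \<Rightarrow> 'a set \<Rightarrow> 'a set \<Rightarrow> ('a \<Rightarrow> 'a \<Rightarrow> 'k) \<Rightarrow> real" where
  "l_bound \<omega>0 \<Lambda> \<mu> \<omega> =
     (if iso_sign \<omega>0 \<Lambda> = 0 then 0
      else let \<delta> = gap (annihilator \<omega> \<mu>) (annihilator \<omega>0 \<Lambda>) in
        sqrt (\<bar>iso_sign \<omega>0 \<Lambda>\<bar> * inverse (reduced_min_modulus \<omega>0 \<Lambda>) *
          (norm (L_map \<omega> - L_map \<omega>0) + norm (L_map \<omega>0) * \<delta> * (2 + \<delta>))))"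

end

theory Submission
  imports Defs
begin

text \<open>
  Every \<open>x \<in> \<mu>\<^sup>\<omega> - \<mu>\<close> can be moved by an element of \<open>\<mu>\<close> and rescaled, without affecting the sign of
  \<open>\<i> \<omega>(x, x)\<close>, so that \<open>\<parallel>x\<parallel> = 1\<close> and \<open>dist(x, \<mu>)\<close> is almost \<open>1\<close> (Riesz). Pick \<open>v \<in> \<lambda>\<^sup>\<omega>\<^sup>0\<close> with \<open>\<parallel>x - v\<parallel>\<close>
  almost at most \<open>\<delta> = \<delta>(\<mu>\<^sup>\<omega>, \<lambda>\<^sup>\<omega>\<^sup>0)\<close>. Passing from \<open>v\<close> to \<open>\<lambda>\<close> and from there to \<open>\<mu>\<close> bounds \<open>dist(v, \<lambda>)\<close>
  from below by almost \<open>(1 - \<eta>) / (1 + \<eta>) - \<delta>\<close>, where \<open>\<eta> = \<delta>(\<lambda>, \<mu>)\<close>, hence by more than \<open>l(\<mu>, \<omega>)\<close>.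
  If \<open>\<lambda>\<close> is Lagrangian, this contradicts \<open>v \<in> \<lambda>\<close>, so \<open>\<mu>\<close> is Lagrangian. Otherwise
  \<open>\<i> h \<omega>\<^sub>0(v, v) \<ge> \<gamma> dist(v, \<lambda>)\<^sup>2 > \<gamma> l\<^sup>2\<close>, and \<open>\<gamma> l\<^sup>2\<close> is exactly the error made when \<open>\<omega>\<^sub>0(v, v)\<close> is replaced
  by \<open>\<omega>(x, x)\<close>; so \<open>\<i> h \<omega>\<close> is positive on \<open>\<mu>\<^sup>\<omega> - \<mu>\<close>, which gives maximality and the sign.
\<close>

section \<open>Distance to a subspace and the gap\<close>

lemma infdist_diff_subspace:
  fixes S :: "'a::real_normed_vector set"
  assumes S: "subspace S" and m: "m \<in> S"
  shows "infdist (x - m) S = infdist x S"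
proof -
  have le: "infdist (y + s) S \<le> infdist y S" if s: "s \<in> S" for y s
  proof -
    have ne: "S \<noteq> {}" using s by auto
    have "infdist (y + s) S \<le> dist y a" if "a \<in> S" for a
      using infdist_le[OF subspace_add[OF S that s], of "y + s"] by (simp add: dist_norm)
    then show ?thesis
      unfolding infdist_notempty[OF ne, of y] using ne by (intro cINF_greatest)
  qed
  from le[OF m, of "x - m"] le[OF subspace_neg[OF S m], of x] show ?thesis by simp
qed

lemma infdist_scaleR_subspace:
  fixes S :: "'a::real_normed_vector set"
  assumes S: "subspace S"
  shows "infdist (c *\<^sub>R x) S = \<bar>c\<bar> * infdist x S"
proof (cases "c = 0")
  case True
  then show ?thesis using subspace_0[OF S] by simp
next
  case False
  have ne: "S \<noteq> {}" using subspace_0[OF S] by auto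
  have le: "infdist (r *\<^sub>R y) S \<le> \<bar>r\<bar> * infdist y S" if "r \<noteq> 0" for r y
  proof -
    have "infdist (r *\<^sub>R y) S / \<bar>r\<bar> \<le> dist y a" if "a \<in> S" for a
    proof -
      have "infdist (r *\<^sub>R y) S \<le> dist (r *\<^sub>R y) (r *\<^sub>R a)"
        by (intro infdist_le subspace_scale[OF S that])
      also have "\<dots> = dist y a * \<bar>r\<bar>"
        by (simp add: dist_norm mult.commute flip: scaleR_right_diff_distrib)
      finally show ?thesis using \<open>r \<noteq> 0\<close> by (simp add: divide_le_eq)
    qed
    then have "infdist (r *\<^sub>R y) S / \<bar>r\<bar> \<le> infdist y S"
      unfolding infdist_notempty[OF ne, of y] using ne by (intro cINF_greatest)
    then show ?thesis using that by (simp add: divide_le_eq mult.commute)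
  qed
  have "\<bar>c\<bar> * infdist x S \<le> infdist (c *\<^sub>R x) S"
    using le[of "inverse c" "c *\<^sub>R x"] False by (simp add: field_simps)
  with le[OF False] show ?thesis by (intro antisym)
qed

lemma infdist_lessE:
  assumes "infdist x S < d" "S \<noteq> {}"
  obtains a where "a \<in> S" "dist x a < d"
proof -
  have "bdd_below (dist x ` S)" by (intro bdd_belowI2[of _ 0]) simp
  then show ?thesis
    using that assms by (auto simp: infdist_notempty cINF_less_iff)
qed

lemma infdist_le_norm:
  assumes "0 \<in> S"
  shows "infdist x S \<le> norm x"
  using infdist_le[OF assms, of x] by simp

lemma bdd_above_infdist_unit:
  assumes "0 \<in> N"
  shows "bdd_above ((\<lambda>u. infdist u N) ` {u \<in> M. norm u = 1})"
  by (intro bdd_aboveI2[of _ _ 1] order_trans[OF infdist_le_norm[OF assms]]) simp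

lemma infdist_le_gap:
  fixes M N :: "'a::real_normed_vector set"
  assumes M: "subspace M" and N: "subspace N" and u: "u \<in> M"
  shows "infdist u N \<le> gap M N * norm u"
proof (cases "u = 0")
  case True
  then show ?thesis using subspace_0[OF N] by simp
next
  case False
  let ?w = "inverse (norm u) *\<^sub>R u"
  have "infdist ?w N \<le> gap M N"
    using False u subspace_scale[OF M u] bdd_above_infdist_unit[OF subspace_0[OF N]]
    by (auto simp: gap_def intro!: cSUP_upper)
  then show ?thesis
    using False by (simp add: infdist_scaleR_subspace[OF N] field_simps)
qed

lemma gap_nonneg:
  fixes M N :: "'a::real_normed_vector set"
  assumes M: "subspace M" and N: "subspace N"
  shows "0 \<le> gap M N"
proof (cases "M = {0}")
  case True
  then show ?thesis by (simp add: gap_def)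
next
  case False
  then obtain u where "u \<in> M" "u \<noteq> 0" using subspace_0[OF M] by auto
  then have "0 \<le> gap M N * norm u"
    using infdist_le_gap[OF M N] order_trans[OF infdist_nonneg] by blast
  then show ?thesis using \<open>u \<noteq> 0\<close> by (simp add: zero_le_mult_iff)
qed

text \<open>Go from \<open>v\<close> to a nearby \<open>a \<in> M\<close> and from \<open>a\<close>
  to \<open>N\<close>; the second leg costs at most \<open>gap M N * norm a\<close>, and
  \<open>norm a \<le> norm v + dist v a\<close>.\<close>

lemma infdist_via_gap:
  fixes M N :: "'a::real_normed_vector set"
  assumes M: "subspace M" and N: "subspace N"
  shows "infdist v N \<le> (1 + gap M N) * infdist v M + gap M N * norm v"
proof -
  have ne: "M \<noteq> {}" using subspace_0[OF M] by auto
  note g = gap_nonneg[OF M N]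
  \<comment> \<open>The estimate is solved for \<open>dist v a\<close>, so that the infimum over
    \<open>a\<close> can be taken.\<close>
  have "(infdist v N - gap M N * norm v) / (1 + gap M N) \<le> dist v a" if a: "a \<in> M" for a
  proof -
    have "infdist v N \<le> infdist a N + dist v a" by (rule infdist_triangle)
    moreover have "infdist a N \<le> gap M N * norm a" by (rule infdist_le_gap[OF M N a])
    moreover have "gap M N * norm a \<le> gap M N * (norm v + dist v a)"
      using norm_triangle_sub[of a v] g by (intro mult_left_mono) (auto simp: dist_norm norm_minus_commute)
    ultimately show ?thesis using g by (simp add: field_simps)
  qed
  then have "(infdist v N - gap M N * norm v) / (1 + gap M N) \<le> infdist v M"
    unfolding infdist_notempty[OF ne, of v] using ne by (intro cINF_greatest)
  then show ?thesis using g by (simp add: field_simps)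
qed

text \<open>Riesz's lemma for a prescribed \<open>x\<close>: \<open>c\<close> and \<open>m\<close>
  are kept explicit so that the value of a form at the unit vector can be traced back to
  \<open>x\<close>.\<close>

lemma riesz_unit_vector:
  fixes S :: "'a::real_normed_vector set"
  assumes S: "subspace S" "closed S" and x: "x \<notin> S" and e: "0 < e"
  obtains c m where "c > 0" "m \<in> S" "norm (c *\<^sub>R (x - m)) = 1" "infdist (c *\<^sub>R (x - m)) S > 1 - e"
proof -
  have ne: "S \<noteq> {}" using subspace_0[OF S(1)] by auto
  let ?D = "infdist x S"
  have D: "?D > 0"
    using in_closed_iff_infdist_zero[OF S(2) ne] x infdist_nonneg[of x S] by force
  have "?D < ?D * (1 + e)" using D e by simp
  then obtain m where m: "m \<in> S" "dist x m < ?D * (1 + e)"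
    by (rule infdist_lessE[OF _ ne])
  have n: "norm (x - m) > 0" using m x by auto
  let ?c = "inverse (norm (x - m))"
  have "1 - e < 1 / (1 + e)" using e by (simp add: field_simps)
  also have "1 / (1 + e) < ?D / norm (x - m)"
    using m(2) n e by (simp add: field_simps dist_norm)
  finally have "1 - e < infdist (?c *\<^sub>R (x - m)) S"
    by (simp add: infdist_scaleR_subspace[OF S(1)] infdist_diff_subspace[OF S(1) m(1)] divide_inverse mult.commute)
  with that[of ?c m] m n show ?thesis by simp
qed

text \<open>Used with \<open>L\<close>, \<open>M\<close> the two isotropic subspaces and
  \<open>N\<close>, \<open>P\<close> their annihilators. One \<open>e\<close> pays for the defect of
  \<open>y\<close>, the other for the gap being only nearly attained.\<close>

lemma gap_transfer:
  fixes L M N P :: "'a::real_normed_vector set"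
  assumes L: "subspace L" and M: "subspace M" and N: "subspace N" and P: "subspace P"
    and y: "y \<in> P" "norm y = 1" "infdist y M > 1 - e" and e: "0 < e"
  obtains v where "v \<in> N" "norm (y - v) < gap P N + e"
    "(1 - gap L M) / (1 + gap L M) - gap P N - 2 * e < infdist v L"
proof -
  let ?\<delta> = "gap P N" and ?\<eta> = "gap L M"
  note \<eta> = gap_nonneg[OF L M]
  have ne: "N \<noteq> {}" using subspace_0[OF N] by auto
  have "infdist y N < ?\<delta> + e" using infdist_le_gap[OF P N y(1)] y e by simp
  then obtain v where v: "v \<in> N" "dist y v < ?\<delta> + e"
    by (rule infdist_lessE[OF _ ne])
  let ?d = "infdist v L"
  have "1 - e < infdist v M + dist y v" using y(3) infdist_triangle[of y M v] by simp
  also have "\<dots> \<le> (1 + ?\<eta>) * ?d + ?\<eta> * norm v + dist y v"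
    using infdist_via_gap[OF L M, of v] by simp
  also have "\<dots> \<le> (1 + ?\<eta>) * ?d + ?\<eta> * (1 + (?\<delta> + e)) + (?\<delta> + e)"
  proof -
    have "norm v \<le> 1 + (?\<delta> + e)"
      using norm_triangle_sub[of v y] y(2) v(2) by (simp add: dist_norm norm_minus_commute)
    then show ?thesis using v(2) \<eta> by (intro add_mono mult_left_mono) auto
  qed
  finally have "1 - ?\<eta> < (1 + ?\<eta>) * (?d + ?\<delta> + 2 * e) - ?\<eta> * e"
    by (simp add: algebra_simps)
  also have "\<dots> \<le> (1 + ?\<eta>) * (?d + ?\<delta> + 2 * e)" using \<eta> e by simp
  finally have "(1 - ?\<eta>) / (1 + ?\<eta>) < ?d + ?\<delta> + 2 * e"
    using \<eta> by (simp add: divide_less_eq mult.commute)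
  with that[of v] v show ?thesis by (simp add: dist_norm)
qed

section \<open>The real quadratic form of a skew symmetric form\<close>

lemma to_complex_0 [simp]: "to_complex (0::'k::rc_field) = 0"
  using norm_to_complex[of "0::'k"] by simp

lemma to_complex_minus: "to_complex (- a :: 'k::rc_field) = - to_complex a"
  using to_complex_scaleR[of "-1" a] by simp

lemma to_complex_diff: "to_complex (a - b :: 'k::rc_field) = to_complex a - to_complex b"
  using to_complex_add[of a "- b"] by (simp add: to_complex_minus)

lemma to_complex_eq_0_iff [simp]: "to_complex (a::'k::rc_field) = 0 \<longleftrightarrow> a = 0"
  using norm_to_complex[of a] by (metis norm_eq_zero)

text \<open>For a skew symmetric form, \<open>Re\<close> discards nothing; over the reals the
  quadratic form is then identically zero.\<close>

definition iquad :: "('a \<Rightarrow> 'a \<Rightarrow> 'k::rc_field) \<Rightarrow> 'a \<Rightarrow> real" where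
  "iquad \<omega> x = Re (\<i> * to_complex (\<omega> x x))"

text \<open>Two forms and two vectors are allowed, to serve both for moving the vector and for
  changing the form.\<close>

lemma abs_iquad_diff_le: "\<bar>iquad \<omega> x - iquad \<omega>' y\<bar> \<le> norm (\<omega> x x - \<omega>' y y)"
proof -
  have "iquad \<omega> x - iquad \<omega>' y = Re (\<i> * to_complex (\<omega> x x - \<omega>' y y))"
    by (simp add: iquad_def to_complex_diff)
  also have "\<bar>\<dots>\<bar> \<le> norm (\<i> * to_complex (\<omega> x x - \<omega>' y y))" by (rule abs_Re_le_cmod)
  finally show ?thesis by (simp add: norm_mult norm_to_complex)
qed

text \<open>Opposite signs of the outer coefficients make the discriminant positive. This will give
  two null vectors on a line.\<close>

lemma quadratic_indefinite_two_zeros: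
  fixes a b c :: real
  assumes "a > 0" "c < 0"
  obtains s t where "s \<noteq> t" "a + s * b + s\<^sup>2 * c = 0" "a + t * b + t\<^sup>2 * c = 0"
proof -
  define D where "D = b\<^sup>2 - 4 * a * c"
  have "a * c < 0" using assms by (simp add: mult_less_0_iff)
  then have D: "D > 0" unfolding D_def using zero_le_power2[of b] by linarith
  have "a + s * b + s\<^sup>2 * c = 0" if "s = (- b + q) / (2 * c)" "q\<^sup>2 = D" for s q
  proof -
    have "2 * c * s + b = q" using that(1) assms by simp
    then have "(2 * c * s + b)\<^sup>2 = b\<^sup>2 - 4 * a * c" using that(2) by (simp add: D_def)
    then have "4 * c * (a + s * b + s\<^sup>2 * c) = 0"
      by (simp add: power2_eq_square algebra_simps)
    then show ?thesis using assms by simp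
  qed
  from this[OF refl, of "sqrt D"] this[OF refl, of "- sqrt D"] D assms show ?thesis
    by (intro that[of "(- b + sqrt D) / (2 * c)" "(- b + - sqrt D) / (2 * c)"]) simp_all
qed

context K_banach
begin

lemma real_subspace:
  assumes "subspace S"
  shows "real_vector.subspace S"
  using assms subspace_scale[of S _ "of_real _"]
  by (auto simp: real_vector.subspace_def subspace_def scale_of_real)

end

context symplectic_banach
begin

sublocale form: bounded_bilinear \<omega>
  by (rule bounded_bilinear_form)

lemma conj_0 [simp]: "conj (0::'k) = 0"
  using conj_of_real[of 0] by simp

lemma orthogonal_sym: "\<omega> x y = 0 \<Longrightarrow> \<omega> y x = 0"
  using skew_symmetric[of y x] by simp

lemma subspace_annihilator: "subspace (annihilator \<omega> S)"
  by (auto simp: subspace_def annihilator_def add_right scale_right form.zero_right)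

text \<open>Skew symmetry makes \<omega>(x, x) purely imaginary, so its real multiple
  \<open>iquad\<close> determines it.\<close>

lemma iquad_eq_0_iff [simp]: "iquad \<omega> x = 0 \<longleftrightarrow> \<omega> x x = 0"
proof -
  have "to_complex (\<omega> x x) = - cnj (to_complex (\<omega> x x))"
    using arg_cong[OF skew_symmetric[of x x], of to_complex]
    by (simp add: to_complex_minus to_complex_conj)
  then have "Re (to_complex (\<omega> x x)) = Re (- cnj (to_complex (\<omega> x x)))" by (rule arg_cong)
  then have "Re (to_complex (\<omega> x x)) = 0" by simp
  then have "to_complex (\<omega> x x) = 0 \<longleftrightarrow> iquad \<omega> x = 0"
    by (auto simp: iquad_def complex_eq_iff)
  then show ?thesis by simp
qed

lemma iquad_add_scaleR:
  "iquad \<omega> (x + t *\<^sub>R y) =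
     iquad \<omega> x + t * Re (\<i> * to_complex (\<omega> x y + \<omega> y x)) + t\<^sup>2 * iquad \<omega> y"
  by (simp add: iquad_def add_left add_right form.scaleR_left form.scaleR_right
      to_complex_add to_complex_scaleR power2_eq_square algebra_simps)

lemma iquad_scaleR: "iquad \<omega> (t *\<^sub>R y) = t\<^sup>2 * iquad \<omega> y"
  using iquad_add_scaleR[of 0 t y] by (simp add: iquad_def form.zero_left form.zero_right)

lemma iquad_diff_isotropic:
  assumes "isotropic smul \<omega> S" "m \<in> S" "x \<in> annihilator \<omega> S"
  shows "iquad \<omega> (x - m) = iquad \<omega> x"
proof -
  have "\<omega> m x = 0" "\<omega> m m = 0" using assms by (auto simp: isotropic_def annihilator_def)
  moreover from this(1) have "\<omega> x m = 0" by (rule orthogonal_sym)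
  ultimately show ?thesis by (simp add: iquad_def form.diff_left form.diff_right)
qed

lemma norm_form_le: "norm (\<omega> x y) \<le> norm (L_map \<omega>) * norm x * norm y"
proof -
  have "norm (\<omega> x y) \<le> norm (L_map \<omega> x) * norm y"
    using norm_blinfun[of "L_map \<omega> x" y] by (simp add: L_map_apply)
  also have "\<dots> \<le> norm (L_map \<omega>) * norm x * norm y"
    by (intro mult_right_mono norm_blinfun norm_ge_zero)
  finally show ?thesis .
qed

section \<open>Maximal isotropic subspaces and the sign\<close>

lemma isotropic_extend:
  assumes S: "isotropic smul \<omega> S" and z: "z \<in> annihilator \<omega> S" "\<omega> z z = 0"
  shows "isotropic smul \<omega> {s + smul c z | s c. s \<in> S}"
proof -
  have sub: "subspace S" and iso: "\<And>s t. s \<in> S \<Longrightarrow> t \<in> S \<Longrightarrow> \<omega> s t = 0"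
    using S by (auto simp: isotropic_def annihilator_def)
  have sz: "\<omega> s z = 0" "\<omega> z s = 0" if "s \<in> S" for s
    using z(1) that orthogonal_sym by (auto simp: annihilator_def)
  have "{s + smul c z | s c. s \<in> S} = {x + y | x y. x \<in> S \<and> y \<in> span {z}}"
    by (auto simp: span_singleton)
  then have "subspace {s + smul c z | s c. s \<in> S}"
    using subspace_sums[OF sub subspace_span] by simp
  then show ?thesis
    using iso sz z(2)
    by (auto simp: isotropic_def annihilator_def add_left add_right scale_left scale_right)
qed

text \<open>Otherwise adjoining the line through \<open>z\<close> would give a strictly larger
  isotropic subspace.\<close>

lemma maximal_isotropic_mem:
  assumes max: "maximal_isotropic smul \<omega> S" and z: "z \<in> annihilator \<omega> S" "\<omega> z z = 0"
  shows "z \<in> S"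
proof -
  let ?T = "{s + smul c z | s c. s \<in> S}"
  have S: "isotropic smul \<omega> S" using max by (simp add: maximal_isotropic_def)
  then have "0 \<in> S" using subspace_0 by (simp add: isotropic_def)
  have "s = s + smul 0 z" for s by simp
  then have "S \<subseteq> ?T" by blast
  with max isotropic_extend[OF S z] have "?T = S" by (simp add: maximal_isotropic_def)
  moreover have "z \<in> ?T" using \<open>0 \<in> S\<close> by (force intro: exI[of _ 1])
  ultimately show ?thesis by simp
qed

text \<open>An isotropic \<open>T\<close> containing \<open>S\<close> lies in the annihilator of
  \<open>S\<close> and consists of null vectors.\<close>

lemma maximal_isotropicI:
  assumes S: "isotropic smul \<omega> S" and nz: "\<And>x. x \<in> annihilator \<omega> S - S \<Longrightarrow> \<omega> x x \<noteq> 0"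
  shows "maximal_isotropic smul \<omega> S"
  using assms unfolding maximal_isotropic_def isotropic_def annihilator_def by blast

lemma positive_definite_i_iff:
  assumes S: "isotropic smul \<omega> S"
  shows "positive_definite_i \<epsilon> \<omega> S \<longleftrightarrow> (\<forall>x \<in> annihilator \<omega> S - S. 0 < \<epsilon> * iquad \<omega> x)"
proof -
  have sub: "subspace S" using S by (simp add: isotropic_def)
  have coset_eq: "coset S x = S \<longleftrightarrow> x \<in> S" for x
  proof
    assume "coset S x = S"
    moreover have "x \<in> coset S x" using subspace_0[OF sub] by (force simp: coset_def)
    ultimately show "x \<in> S" by simp
  next
    assume x: "x \<in> S"
    have "s \<in> coset S x" if "s \<in> S" for s
      using subspace_diff[OF sub that x] by (force simp: coset_def)
    with subspace_add[OF sub x] show "coset S x = S" by (auto simp: coset_def)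
  qed
  show ?thesis
    by (auto simp: positive_definite_i_def coset_eq quotient_form_coset[OF S] iquad_def)
qed

text \<open>If both signs fail, there are \<open>x\<close> and \<open>y\<close> outside
  \<open>S\<close> with positive and negative values. The line through \<open>x\<close> in direction
  \<open>y\<close> carries two distinct null vectors; both lie in \<open>S\<close> by maximality,
  and their difference forces \<open>y \<in> S\<close>.\<close>

lemma maximal_isotropic_definite:
  assumes max: "maximal_isotropic smul \<omega> S"
  shows "positive_definite_i 1 \<omega> S \<or> positive_definite_i (-1) \<omega> S"
proof (rule ccontr)
  have S: "isotropic smul \<omega> S" using max by (simp add: maximal_isotropic_def)
  then have sub: "subspace S" by (simp add: isotropic_def)
  note rsub = real_subspace[OF sub] real_subspace[OF subspace_annihilator, of S]
  assume "\<not> ?thesis"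
  then obtain x y where x: "x \<in> annihilator \<omega> S - S" "\<not> iquad \<omega> x < 0"
    and y: "y \<in> annihilator \<omega> S - S" "\<not> 0 < iquad \<omega> y"
    by (auto simp: positive_definite_i_iff[OF S])
  have nz: "iquad \<omega> w \<noteq> 0" if "w \<in> annihilator \<omega> S - S" for w
    using maximal_isotropic_mem[OF max, of w] that by auto
  from nz[OF x(1)] nz[OF y(1)] x(2) y(2) have "iquad \<omega> x > 0" "iquad \<omega> y < 0"
    by linarith+
  then obtain s t where st: "s \<noteq> t" "iquad \<omega> (x + s *\<^sub>R y) = 0" "iquad \<omega> (x + t *\<^sub>R y) = 0"
    by (metis quadratic_indefinite_two_zeros iquad_add_scaleR)
  have "x + r *\<^sub>R y \<in> annihilator \<omega> S" for r
    using x y rsub(2) by (auto intro!: real_vector.subspace_add real_vector.subspace_scale)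
  with st maximal_isotropic_mem[OF max] have "x + s *\<^sub>R y \<in> S" "x + t *\<^sub>R y \<in> S" by auto
  then have "(x + s *\<^sub>R y) - (x + t *\<^sub>R y) \<in> S"
    by (rule real_vector.subspace_diff[OF rsub(1)])
  then have "(s - t) *\<^sub>R y \<in> S" by (simp add: scaleR_left_diff_distrib)
  then have "inverse (s - t) *\<^sub>R (s - t) *\<^sub>R y \<in> S"
    by (rule real_vector.subspace_scale[OF rsub(1)])
  then have "y \<in> S" using st(1) by simp
  with y show False by simp
qed

lemma iso_sign_cases:
  assumes max: "maximal_isotropic smul \<omega> S" and ne: "S \<noteq> annihilator \<omega> S"
  shows "iso_sign \<omega> S \<in> {1, -1}" and "positive_definite_i (iso_sign \<omega> S) \<omega> S"
  using maximal_isotropic_definite[OF max] ne by (auto simp: iso_sign_def)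

lemma iso_sign_eqI:
  assumes S: "isotropic smul \<omega> S" and ne: "S \<noteq> annihilator \<omega> S"
    and h: "h \<in> {1, -1}" and pos: "\<And>x. x \<in> annihilator \<omega> S - S \<Longrightarrow> 0 < h * iquad \<omega> x"
  shows "iso_sign \<omega> S = h"
proof -
  \<comment> \<open>\<open>iso_sign\<close> tests the sign 1 first, so for \<open>h = -1\<close> a
    witness is required to refute that test.\<close>
  obtain x where x: "x \<in> annihilator \<omega> S - S" using S ne by (auto simp: isotropic_def)
  have "positive_definite_i h \<omega> S" using pos positive_definite_i_iff[OF S] by simp
  moreover have "\<not> positive_definite_i 1 \<omega> S" if "h = -1"
    using pos[OF x] that x by (force simp: positive_definite_i_iff[OF S])
  ultimately show ?thesis using h ne by (auto simp: iso_sign_def)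
qed

lemma reduced_min_modulus_le:
  assumes max: "maximal_isotropic smul \<omega> S" and ne: "S \<noteq> annihilator \<omega> S"
    and x: "x \<in> annihilator \<omega> S"
  shows "reduced_min_modulus \<omega> S * (infdist x S)\<^sup>2 \<le> iso_sign \<omega> S * iquad \<omega> x"
proof (cases "x \<in> S")
  case True
  then have "\<omega> x x = 0" using x by (auto simp: annihilator_def)
  with True show ?thesis by (simp add: iquad_def)
next
  case False
  let ?f = "\<lambda>x. iso_sign \<omega> S * iquad \<omega> x / (infdist x S)\<^sup>2"
  have S: "isotropic smul \<omega> S" using max by (simp add: maximal_isotropic_def)
  have pos: "0 < iso_sign \<omega> S * iquad \<omega> y" if "y \<in> annihilator \<omega> S - S" for y
    using iso_sign_cases(2)[OF max ne] that positive_definite_i_iff[OF S] by blast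
  have "Re (\<i> * of_real h * c) = h * Re (\<i> * c)" for h c by simp
  then have "reduced_min_modulus \<omega> S = (INF x \<in> annihilator \<omega> S - S. ?f x)"
    using ne by (simp only: reduced_min_modulus_def iquad_def if_False)
  also have "\<dots> \<le> ?f x"
    using x False pos by (intro cINF_lower bdd_belowI2[of _ 0])
      (auto intro!: divide_nonneg_nonneg intro: less_imp_le)
  finally have "reduced_min_modulus \<omega> S \<le> ?f x" .
  \<comment> \<open>If \<open>infdist x S = 0\<close>, the quotient carries no information, but the
    left side vanishes and \<open>pos\<close> suffices.\<close>
  then show ?thesis
    using pos[of x] x False infdist_nonneg[of x S]
    by (cases "infdist x S = 0") (auto simp: pos_le_divide_eq)
qed

text \<open>Telescoping \<omega>(y, y) - \<omega>(v, v) puts the small vector \<open>y - v\<close>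
  into one slot of each term; the factor \<open>2 + d\<close> is a bound for
  \<open>norm y + norm v\<close>.\<close>

lemma iquad_diff_le:
  assumes "norm y = 1" "norm (y - v) \<le> d"
  shows "\<bar>iquad \<omega> y - iquad \<omega> v\<bar> \<le> norm (L_map \<omega>) * d * (2 + d)"
proof -
  have "\<omega> y y - \<omega> v v = \<omega> (y - v) y + \<omega> v (y - v)"
    by (simp add: form.diff_left form.diff_right)
  then have "\<bar>iquad \<omega> y - iquad \<omega> v\<bar> \<le> norm (\<omega> (y - v) y) + norm (\<omega> v (y - v))"
    using abs_iquad_diff_le[of \<omega> y \<omega> v] norm_triangle_ineq[of "\<omega> (y - v) y" "\<omega> v (y - v)"] by simp
  also have "\<dots> \<le> norm (L_map \<omega>) * norm (y - v) * norm y + norm (L_map \<omega>) * norm v * norm (y - v)"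
    by (intro add_mono norm_form_le)
  also have "\<dots> = norm (L_map \<omega>) * norm (y - v) * (1 + norm v)"
    using assms by (simp add: algebra_simps)
  also have "\<dots> \<le> norm (L_map \<omega>) * d * (2 + d)"
  proof -
    have "norm v \<le> 1 + d"
      using norm_triangle_sub[of v y] assms by (simp add: norm_minus_commute)
    then show ?thesis
      using assms(2) order_trans[OF norm_ge_zero assms(2)] by (intro mult_mono) auto
  qed
  finally show ?thesis .
qed

end

lemma abs_iquad_two_forms_le:
  assumes "symplectic_banach smul \<omega>" "symplectic_banach smul \<omega>'" and "norm y = 1"
  shows "\<bar>iquad \<omega> y - iquad \<omega>' y\<bar> \<le> norm (L_map \<omega> - L_map \<omega>')"
proof -
  interpret s: symplectic_banach smul \<omega> by fact
  interpret s': symplectic_banach smul \<omega>' by fact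
  have "\<omega> y y - \<omega>' y y = (L_map \<omega> - L_map \<omega>') y y"
    by (simp add: blinfun.diff_left s.L_map_apply s'.L_map_apply)
  also have "norm \<dots> \<le> norm ((L_map \<omega> - L_map \<omega>') y) * norm y" by (rule norm_blinfun)
  also have "\<dots> \<le> norm (L_map \<omega> - L_map \<omega>') * norm y * norm y"
    by (intro mult_right_mono norm_blinfun norm_ge_zero)
  finally show ?thesis using abs_iquad_diff_le[of \<omega> y \<omega>' y] assms(3) by simp
qed

section \<open>Perturbation of maximal isotropic subspaces\<close>

theorem theorem1p1:
  fixes smul :: "'k::rc_field \<Rightarrow> 'a::banach \<Rightarrow> 'a"
    and \<omega>0 \<omega> :: "'a \<Rightarrow> 'a \<Rightarrow> 'k"
    and \<Lambda> \<mu> :: "'a set"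
  assumes "symplectic_banach smul \<omega>0"
    and "maximal_isotropic smul \<omega>0 \<Lambda>"
    and "iso_sign \<omega>0 \<Lambda> \<noteq> 0 \<Longrightarrow> reduced_min_modulus \<omega>0 \<Lambda> > 0"
    and "symplectic_banach smul \<omega>"
    and "isotropic smul \<omega> \<mu>" and "closed \<mu>"
    and "gap (annihilator \<omega> \<mu>) (annihilator \<omega>0 \<Lambda>) + l_bound \<omega>0 \<Lambda> \<mu> \<omega>
           < (1 - gap \<Lambda> \<mu>) / (1 + gap \<Lambda> \<mu>)"
  shows "maximal_isotropic smul \<omega> \<mu> \<and> iso_sign \<omega> \<mu> \<in> {iso_sign \<omega>0 \<Lambda>, 0}"
proof -
  interpret s0: symplectic_banach smul \<omega>0 by fact
  interpret s: symplectic_banach smul \<omega> by fact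
  define \<delta> where "\<delta> = gap (annihilator \<omega> \<mu>) (annihilator \<omega>0 \<Lambda>)"
  \<comment> \<open>The limiting lower bound for \<open>infdist v \<Lambda>\<close> as the slack
    \<open>e\<close> tends to 0; the main assumption says that it exceeds
    \<open>l_bound\<close>.\<close>
  define r where "r = (1 - gap \<Lambda> \<mu>) / (1 + gap \<Lambda> \<mu>) - \<delta>"
  have r: "l_bound \<omega>0 \<Lambda> \<mu> \<omega> < r" using assms(7) by (simp add: r_def \<delta>_def)
  have \<Lambda>: "isotropic smul \<omega>0 \<Lambda>" using assms(2) by (simp add: maximal_isotropic_def)
  have sub: "subspace \<Lambda>" "subspace \<mu>" "subspace (annihilator \<omega>0 \<Lambda>)" "subspace (annihilator \<omega> \<mu>)"
    using \<Lambda> assms(5) s0.subspace_annihilator s.subspace_annihilator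
    by (auto intro!: s0.real_subspace simp: isotropic_def)
  have \<delta>0: "0 \<le> \<delta>" unfolding \<delta>_def by (rule gap_nonneg[OF sub(4,3)])
  have \<mu>_sub: "\<mu> \<subseteq> annihilator \<omega> \<mu>" using assms(5) by (simp add: isotropic_def)
  have approx: "\<exists>c m v. c > 0 \<and> m \<in> \<mu> \<and> norm (c *\<^sub>R (x - m)) = 1 \<and> v \<in> annihilator \<omega>0 \<Lambda> \<and>
      norm (c *\<^sub>R (x - m) - v) < \<delta> + e \<and> r - 2 * e < infdist v \<Lambda>"
    if x: "x \<in> annihilator \<omega> \<mu> - \<mu>" and e: "e > 0" for x e
  proof -
    obtain c m where cm: "c > 0" "m \<in> \<mu>" "norm (c *\<^sub>R (x - m)) = 1"
      "infdist (c *\<^sub>R (x - m)) \<mu> > 1 - e"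
      using riesz_unit_vector[OF sub(2) assms(6) _ e, of x] x by auto
    have "c *\<^sub>R (x - m) \<in> annihilator \<omega> \<mu>"
      using x cm \<mu>_sub by (auto intro!: subspace_scale subspace_diff sub)
    from gap_transfer[OF sub(1,2,3,4) this cm(3,4) e]
    show ?thesis using cm unfolding r_def \<delta>_def by metis
  qed
  show ?thesis
  proof (cases "\<Lambda> = annihilator \<omega>0 \<Lambda>")
    case True
    then have h0: "iso_sign \<omega>0 \<Lambda> = 0" by (simp add: iso_sign_def)
    then have r0: "r > 0" using r by (simp add: l_bound_def)
    have "annihilator \<omega> \<mu> \<subseteq> \<mu>"
    proof
      fix x assume "x \<in> annihilator \<omega> \<mu>"
      \<comment> \<open>With \<open>e = r / 2\<close> the bound reads
        \<open>0 < infdist v \<Lambda>\<close>, although \<open>v \<in> \<Lambda>\<close>.\<close>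
      then show "x \<in> \<mu>" using approx[of x "r / 2"] r0 True by force
    qed
    then have "\<mu> = annihilator \<omega> \<mu>" using \<mu>_sub by simp
    then show ?thesis
      using h0 s.maximal_isotropicI[OF assms(5)] by (auto simp: iso_sign_def)
  next
    case False
    define h where "h = iso_sign \<omega>0 \<Lambda>"
    define \<gamma> where "\<gamma> = reduced_min_modulus \<omega>0 \<Lambda>"
    define A where "A = norm (L_map \<omega> - L_map \<omega>0)"
    define B where "B = norm (L_map \<omega>0)"
    have h: "h \<in> {1, -1}" unfolding h_def by (rule s0.iso_sign_cases(1)[OF assms(2) False])
    then have "h \<noteq> 0" and abs_h: "\<bar>h * t\<bar> = \<bar>t\<bar>" for t by auto
    then have \<gamma>: "\<gamma> > 0" using assms(3) by (simp add: h_def \<gamma>_def)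
    have AB: "0 \<le> A + B * \<delta> * (2 + \<delta>)" using \<delta>0 by (simp add: A_def B_def)
    have l: "l_bound \<omega>0 \<Lambda> \<mu> \<omega> = sqrt ((A + B * \<delta> * (2 + \<delta>)) / \<gamma>)"
      using h \<open>h \<noteq> 0\<close> by (auto simp: l_bound_def Let_def h_def \<gamma>_def A_def B_def \<delta>_def divide_inverse mult.commute)
    have r0: "r > 0" using r AB \<gamma> l by (auto intro: le_less_trans[rotated])
    \<comment> \<open>Squaring the assumption leaves a strict margin at \<open>e = 0\<close>, which
      by continuity persists for small positive \<open>e\<close>.\<close>
    have "(A + B * \<delta> * (2 + \<delta>)) / \<gamma> < r\<^sup>2"
      using power_strict_mono[OF r[unfolded l], of 2] AB \<gamma> by simp
    then have lim: "0 < \<gamma> * r\<^sup>2 - A - B * \<delta> * (2 + \<delta>)"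
      using \<gamma> by (simp add: field_simps)
    have "((\<lambda>e. \<gamma> * (r - 2 * e)\<^sup>2 - A - B * (\<delta> + e) * (2 + (\<delta> + e))) \<longlongrightarrow>
        \<gamma> * (r - 2 * 0)\<^sup>2 - A - B * (\<delta> + 0) * (2 + (\<delta> + 0))) (at_right 0)"
      by (intro tendsto_intros)
    then have ev1: "\<forall>\<^sub>F e in at_right 0. 0 < \<gamma> * (r - 2 * e)\<^sup>2 - A - B * (\<delta> + e) * (2 + (\<delta> + e))"
      using lim by (intro order_tendstoD(1)) auto
    \<comment> \<open>The bound \<open>e < r / 2\<close> keeps \<open>r - 2 * e\<close> positive, so
      that the lower bound on the distance may be squared.\<close>
    have ev2: "\<forall>\<^sub>F e in at_right 0. 0 < e \<and> e < r / 2"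
      using eventually_at_right_real[of 0 "r / 2"] r0 by (auto elim: eventually_mono)
    obtain e where e: "0 < e" "e < r / 2"
      and pos: "0 < \<gamma> * (r - 2 * e)\<^sup>2 - A - B * (\<delta> + e) * (2 + (\<delta> + e))"
      using eventually_happens'[OF _ eventually_conj[OF ev1 ev2]] by auto
    have definite: "0 < h * iquad \<omega> x" if x: "x \<in> annihilator \<omega> \<mu> - \<mu>" for x
    proof -
      obtain c m v where c: "c > 0" "m \<in> \<mu>" and y: "norm (c *\<^sub>R (x - m)) = 1"
        and v: "v \<in> annihilator \<omega>0 \<Lambda>" "norm (c *\<^sub>R (x - m) - v) < \<delta> + e"
          "r - 2 * e < infdist v \<Lambda>"
        using approx[OF x e(1)] by blast
      define y where "y = c *\<^sub>R (x - m)"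
      note y = y[folded y_def] and v = v[folded y_def]
      have "(r - 2 * e)\<^sup>2 \<le> (infdist v \<Lambda>)\<^sup>2" using v(3) e by (intro power_mono) auto
      then have "\<gamma> * (r - 2 * e)\<^sup>2 \<le> \<gamma> * (infdist v \<Lambda>)\<^sup>2" using \<gamma> by simp
      also have "\<dots> \<le> h * iquad \<omega>0 v"
        unfolding \<gamma>_def h_def by (rule s0.reduced_min_modulus_le[OF assms(2) False v(1)])
      finally have 1: "\<gamma> * (r - 2 * e)\<^sup>2 \<le> h * iquad \<omega>0 v" .
      have 2: "\<bar>h * (iquad \<omega>0 y - iquad \<omega>0 v)\<bar> \<le> B * (\<delta> + e) * (2 + (\<delta> + e))"
        unfolding abs_h B_def using s0.iquad_diff_le[OF y] v(2) by simp
      have 3: "\<bar>h * (iquad \<omega> y - iquad \<omega>0 y)\<bar> \<le> A"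
        unfolding abs_h A_def by (rule abs_iquad_two_forms_le[OF assms(4,1) y])
      \<comment> \<open>Replacing \<open>v\<close> by \<open>y\<close> costs at most
        \<open>B * (\<delta> + e) * (2 + (\<delta> + e))\<close> and replacing
        \<open>\<omega>0\<close> by \<open>\<omega>\<close> at most \<open>A\<close>;
        \<open>pos\<close> covers both.\<close>
      have "0 < h * iquad \<omega> y"
        using 1 2 3 pos unfolding right_diff_distrib by linarith
      \<comment> \<open>Back to \<open>x\<close>: subtracting \<open>m \<in> \<mu>\<close> leaves
        the value unchanged, and scaling by \<open>c\<close> multiplies it by a positive
        factor.\<close>
      moreover have "iquad \<omega> y = c\<^sup>2 * iquad \<omega> x"
        using s.iquad_diff_isotropic[OF assms(5) c(2)] x by (simp add: y_def s.iquad_scaleR)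
      ultimately have "0 < c\<^sup>2 * (h * iquad \<omega> x)" by (simp only: mult.left_commute)
      then show ?thesis by (rule zero_less_mult_pos) (use c(1) in simp)
    qed
    have "maximal_isotropic smul \<omega> \<mu>"
      using definite by (intro s.maximal_isotropicI assms(5)) (fastforce simp: iquad_def)
    moreover have "iso_sign \<omega> \<mu> = h" if "\<mu> \<noteq> annihilator \<omega> \<mu>"
      by (rule s.iso_sign_eqI[OF assms(5) that h definite])
    moreover have "iso_sign \<omega> \<mu> = 0" if "\<mu> = annihilator \<omega> \<mu>"
      using that by (simp add: iso_sign_def)
    ultimately show ?thesis unfolding h_def by auto
  qed
qed

end
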